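(* Let $k\geq2$. For every $M\in\{1,2,\dots\}\cup\{\infty\}$ and every $N\in\{0,1,2,\dots\}$, the oriented graph $\vec{SW}_{k,N,M}$ and the non-oriented graph $SW_{k,N,M}$ are weakly vertex-transitive (i.e. their automorphism groups, as unlabeled graphs, act transitively on vertices) if and only if $M\geq N$ (with $\infty\ge N$ for all $N$).
   Context: Loops and multiple edges allowed. The oriented spider-web graph $\vec{SW}_{k,N,M}$ has vertex set $\{0,\dots,k-1\}^N\times\mathbb Z/M\mathbb Z$ (with $\mathbb Z/\infty\mathbb Z:=\mathbb Z$) and, for each vertex $(x_1\dots x_N,i)$ and each $y\in\{0,\dots,k-1\}$, one edge labeled $R_y$ from $(x_1\dots x_N,i)$ to $(x_2\dots x_Ny,i+1)$. $SW_{k,N,M}$ is its underlying non-oriented graph (each edge $e$ gets a formal inverse $\bar e$). Weak automorphisms are graph automorphisms that need not preserve labels. *)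

theory Defs
  imports
    "Graph_Theory.Bidirected_Digraph"
    "Graph_Theory.Digraph_Isomorphism"
    "HOL-Algebra.Elementary_Groups"
    "HOL-Library.Extended_Nat"
begin

text \<open>
  \<open>\<int>/M\<int>\<close>, with \<open>\<int>/\<infinity>\<int> = \<int>\<close>. For finite \<open>M = m > 0\<close> the elements are the representatives \<open>0, \<dots>, m - 1\<close>.
  The value \<open>M = 0\<close> is never used.
\<close>

definition cyclic_group :: "enat \<Rightarrow> int monoid" where
  "cyclic_group M = (case M of enat m \<Rightarrow> integer_mod_group m | \<infinity> \<Rightarrow> integer_group)"

text \<open>
  A non-oriented graph is a digraph together with an involution \<open>arev\<close> pairing each arc with
  its formal inverse (\<^locale>\<open>bidirected_digraph\<close>). In the underlying non-oriented graph of
  \<open>G\<close>, the arc \<open>(e, True)\<close> is the original arc \<open>e\<close> and \<open>(e, False)\<close> is its formal inverse; the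
  two are distinct even when \<open>e\<close> is a loop.
\<close>

definition underlying_graph :: "('a, 'b) pre_digraph \<Rightarrow> ('a, 'b \<times> bool) pre_digraph" where
  "underlying_graph G = \<lparr>
     verts = verts G,
     arcs = arcs G \<times> UNIV,
     tail = (\<lambda>(e, b). if b then tail G e else head G e),
     head = (\<lambda>(e, b). if b then head G e else tail G e)\<rparr>"

text \<open>Outside the arcs the map is the identity, as \<^locale>\<open>bidirected_digraph\<close> requires.\<close>

definition underlying_rev :: "('a, 'b) pre_digraph \<Rightarrow> 'b \<times> bool \<Rightarrow> 'b \<times> bool" where
  "underlying_rev G = (\<lambda>(e, b). if e \<in> arcs G then (e, \<not> b) else (e, b))"

lemma bidirected_underlying_graph:
  assumes "wf_digraph G"
  shows "bidirected_digraph (underlying_graph G) (underlying_rev G)"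
proof -
  interpret wf_digraph G by fact
  show ?thesis
    by unfold_locales (auto simp: underlying_graph_def underlying_rev_def split: if_splits)
qed

text \<open>
  The digraphs below carry no labelling, so that their automorphisms are the weak automorphisms
  of the labelled graphs. An automorphism acts on vertices and on arcs: parallel arcs may be
  permuted.
\<close>

definition digraph_automorphisms ::
    "('a, 'b) pre_digraph \<Rightarrow> ('a, 'b, 'a, 'b) digraph_isomorphism set" where
  "digraph_automorphisms G = {h. pre_digraph.digraph_isomorphism G h \<and> app_iso h G = G}"

definition graph_automorphisms ::
    "('a, 'b) pre_digraph \<Rightarrow> ('b \<Rightarrow> 'b) \<Rightarrow> ('a, 'b, 'a, 'b) digraph_isomorphism set" where
  "graph_automorphisms G arev =
     {h \<in> digraph_automorphisms G. \<forall>a\<in>arcs G. iso_arcs h (arev a) = arev (iso_arcs h a)}"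

definition transitive_on_verts ::
    "('a, 'b, 'a, 'b) digraph_isomorphism set \<Rightarrow> ('a, 'b) pre_digraph \<Rightarrow> bool" where
  "transitive_on_verts H G \<longleftrightarrow> (\<forall>u\<in>verts G. \<forall>v\<in>verts G. \<exists>h\<in>H. iso_verts h u = v)"

definition weakly_vertex_transitive_digraph :: "('a, 'b) pre_digraph \<Rightarrow> bool" where
  "weakly_vertex_transitive_digraph G \<longleftrightarrow> transitive_on_verts (digraph_automorphisms G) G"

definition weakly_vertex_transitive_graph :: "('a, 'b) pre_digraph \<Rightarrow> ('b \<Rightarrow> 'b) \<Rightarrow> bool" where
  "weakly_vertex_transitive_graph G arev \<longleftrightarrow> transitive_on_verts (graph_automorphisms G arev) G"

type_synonym sw_vertex = "nat list \<times> int"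

definition sw_verts :: "nat \<Rightarrow> nat \<Rightarrow> enat \<Rightarrow> sw_vertex set" where
  "sw_verts k N M = {xs. length xs = N \<and> set xs \<subseteq> {..<k}} \<times> carrier (cyclic_group M)"

text \<open>
  For \<open>N = 0\<close> the word \<open>tl (xs @ [y])\<close> is again the empty word, so each vertex has
  \<open>k\<close> parallel out-going arcs. The product in \<^const>\<open>cyclic_group\<close> reduces its result, so that
  \<open>i \<otimes> 1\<close> is the class of \<open>i + 1\<close> also for \<open>M = 1\<close>.
\<close>

definition sw_step :: "enat \<Rightarrow> sw_vertex \<Rightarrow> nat \<Rightarrow> sw_vertex" where
  "sw_step M = (\<lambda>(xs, i) y. (tl (xs @ [y]), i \<otimes>\<^bsub>cyclic_group M\<^esub> 1))"

text \<open>The arc \<open>(v, y)\<close> is the one starting at \<open>v\<close> with label \<open>R\<^sub>y\<close>.\<close>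

definition oriented_spider_web ::
    "nat \<Rightarrow> nat \<Rightarrow> enat \<Rightarrow> (sw_vertex, sw_vertex \<times> nat) pre_digraph" where
  "oriented_spider_web k N M = \<lparr>
     verts = sw_verts k N M,
     arcs = sw_verts k N M \<times> {..<k},
     tail = fst,
     head = (\<lambda>(v, y). sw_step M v y)\<rparr>"

definition spider_web ::
    "nat \<Rightarrow> nat \<Rightarrow> enat \<Rightarrow> (sw_vertex, (sw_vertex \<times> nat) \<times> bool) pre_digraph" where
  "spider_web k N M = underlying_graph (oriented_spider_web k N M)"

definition spider_web_rev ::
    "nat \<Rightarrow> nat \<Rightarrow> enat \<Rightarrow> (sw_vertex \<times> nat) \<times> bool \<Rightarrow> (sw_vertex \<times> nat) \<times> bool" where
  "spider_web_rev k N M = underlying_rev (oriented_spider_web k N M)"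

lemma cyclic_group_succ_closed:
  assumes "M \<ge> 1" and "i \<in> carrier (cyclic_group M)"
  shows "i \<otimes>\<^bsub>cyclic_group M\<^esub> 1 \<in> carrier (cyclic_group M)"
  using assms
  by (cases M) (auto simp: cyclic_group_def integer_mod_group_def integer_group_def one_enat_def)

lemma sw_step_closed:
  assumes "M \<ge> 1" and "v \<in> sw_verts k N M" and "y < k"
  shows "sw_step M v y \<in> sw_verts k N M"
proof -
  obtain xs i where v: "v = (xs, i)" by (cases v)
  have "set (tl (xs @ [y])) \<subseteq> set (xs @ [y])"
    by (cases "xs @ [y]") auto
  then show ?thesis
    using assms cyclic_group_succ_closed[of M i] v
    by (auto simp: sw_verts_def sw_step_def)
qed

lemma wf_oriented_spider_web:
  assumes "M \<ge> 1"
  shows "wf_digraph (oriented_spider_web k N M)"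
  using sw_step_closed[OF assms]
  by unfold_locales (auto simp: oriented_spider_web_def)

lemma bidirected_spider_web:
  assumes "M \<ge> 1"
  shows "bidirected_digraph (spider_web k N M) (spider_web_rev k N M)"
  unfolding spider_web_def spider_web_rev_def
  by (rule bidirected_underlying_graph[OF wf_oriented_spider_web[OF assms]])

end

theory Submission
  imports Defs
begin

text \<open>
  Letters keep their absolute position modulo \<open>M\<close> along arcs, so they may be permuted by any
  \<open>M\<close>-periodic family of permutations. If \<open>M \<ge> N\<close>, the positions occupied by one word are
  pairwise incongruent, and such a relabelling followed by a rotation carries any vertex to any other.

  If \<open>M < N\<close>, count the closed walks of length \<open>M\<close> at a vertex of the non-oriented graph. Those with
  net displacement \<open>0\<close> lift to closed walks in the cover \<open>SW\<^sub>k\<^sub>,\<^sub>N\<^sub>,\<^sub>\<infinity>\<close>, which is transitive, so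
  their number does not depend on the vertex. The others go forwards or backwards only, and
  exist precisely at the \<open>M\<close>-periodic words: at \<open>0\<dots>00\<close> but not at \<open>0\<dots>01\<close>.
\<close>

section \<open>Words and the cyclic group\<close>

text \<open>The value 0 for \<open>\<infinity>\<close> exploits \<open>x mod 0 = x\<close>:
  reduction becomes the identity, and one formula serves the integers and their finite
  quotients.\<close>

definition modulus :: "enat \<Rightarrow> int" where
  "modulus M = (case M of enat m \<Rightarrow> int m | \<infinity> \<Rightarrow> 0)"

lemma modulus_enat [simp]: "modulus (enat m) = int m"
  by (simp add: modulus_def)

lemma cyclic_group_mult: "i \<otimes>\<^bsub>cyclic_group M\<^esub> j = (i + j) mod modulus M"
  by (cases M) (auto simp: cyclic_group_def modulus_def integer_mod_group_def integer_group_def)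

lemma carrier_cyclic_group_iff: "i \<in> carrier (cyclic_group M) \<longleftrightarrow> i mod modulus M = i"
proof (cases M)
  case (enat m)
  show ?thesis
  proof (cases "m = 0")
    case False
    then have "i mod int m = i \<longleftrightarrow> i \<in> {0..<int m}"
      by (auto simp: mod_eq_self_iff_div_eq_0 zdiv_eq_0_iff)
    then show ?thesis
      using False by (simp add: enat cyclic_group_def integer_mod_group_def)
  qed (simp add: enat cyclic_group_def integer_mod_group_def integer_group_def)
next
  case infinity
  then show ?thesis
    by (simp add: cyclic_group_def modulus_def integer_group_def)
qed

primrec map_from :: "(int \<Rightarrow> 'a \<Rightarrow> 'b) \<Rightarrow> int \<Rightarrow> 'a list \<Rightarrow> 'b list" where
  "map_from \<sigma> p [] = []"
| "map_from \<sigma> p (x # xs) = \<sigma> p x # map_from \<sigma> (p + 1) xs"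

lemma length_map_from [simp]: "length (map_from \<sigma> p xs) = length xs"
  by (induction xs arbitrary: p) auto

lemma map_from_snoc: "map_from \<sigma> p (xs @ [y]) = map_from \<sigma> p xs @ [\<sigma> (p + int (length xs)) y]"
  by (induction xs arbitrary: p) (auto simp: algebra_simps)

lemma map_from_tl: "map_from \<sigma> (p + 1) (tl xs) = tl (map_from \<sigma> p xs)"
  by (cases xs) auto

lemma nth_map_from: "n < length xs \<Longrightarrow> map_from \<sigma> p xs ! n = \<sigma> (p + int n) (xs ! n)"
proof (induction xs arbitrary: p n)
  case (Cons x xs)
  then show ?case
    by (cases n) (simp_all add: ac_simps)
qed simp

lemma map_from_inverse:
  "(\<And>q x. \<tau> q (\<sigma> q x) = x) \<Longrightarrow> map_from \<tau> p (map_from \<sigma> p xs) = xs"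
  by (induction xs arbitrary: p) auto

lemma set_map_from_subset:
  "(\<And>q x. x \<in> A \<Longrightarrow> \<sigma> q x \<in> B) \<Longrightarrow> set xs \<subseteq> A \<Longrightarrow> set (map_from \<sigma> p xs) \<subseteq> B"
  by (induction xs arbitrary: p) auto

lemma map_from_mod:
  assumes "\<And>q. \<sigma> (q mod m) = \<sigma> q"
  shows "map_from \<sigma> (p mod m) xs = map_from \<sigma> p xs"
proof (induction xs arbitrary: p)
  case (Cons x xs)
  \<comment> \<open>The tail starts at \<open>p mod m + 1\<close>, which need not be a residue any
    more, so the induction hypothesis is used here to reduce it and again at
    \<open>p + 1\<close>.\<close>
  have "map_from \<sigma> (p mod m + 1) xs = map_from \<sigma> ((p mod m + 1) mod m) xs"
    using Cons.IH by simp
  also have "\<dots> = map_from \<sigma> ((p + 1) mod m) xs"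
    by (simp add: mod_simps)
  finally show ?case
    using Cons.IH assms by simp
qed simp

section \<open>Relabelling letters position by position\<close>

text \<open>
  The letter \<open>x\<^sub>n\<close> (counted from \<open>0\<close>) of a word at level \<open>i\<close> sits at the absolute
  position \<open>i + n\<close>; moving along an arc keeps the positions of the surviving letters.
  Hence applying a permutation \<open>\<sigma> p\<close> to the letters at position \<open>p\<close>, for every \<open>p\<close>, commutes
  with the arcs. The level \<open>i\<close> is an integer, of which the second component of the
  vertex records only the residue class.
\<close>

definition relabel_vert ::
    "enat \<Rightarrow> (int \<Rightarrow> nat \<Rightarrow> nat) \<Rightarrow> int \<Rightarrow> int \<Rightarrow> sw_vertex \<Rightarrow> sw_vertex" where
  "relabel_vert M \<sigma> t i = (\<lambda>(xs, c). (map_from \<sigma> i xs, (c + t) mod modulus M))"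

definition relabel_arc ::
    "enat \<Rightarrow> (int \<Rightarrow> nat \<Rightarrow> nat) \<Rightarrow> int \<Rightarrow> int \<Rightarrow> sw_vertex \<times> nat \<Rightarrow> sw_vertex \<times> nat" where
  "relabel_arc M \<sigma> t i =
     (\<lambda>(v, y). (relabel_vert M \<sigma> t i v, \<sigma> (i + int (length (fst v))) y))"

lemma sw_step_relabel:
  "sw_step M (relabel_vert M \<sigma> t i v) (\<sigma> (i + int (length (fst v))) y) =
   relabel_vert M \<sigma> t (i + 1) (sw_step M v y)"
proof (cases v)
  case (Pair xs c)
  have "((c + t) mod modulus M + 1) mod modulus M = ((c + 1) mod modulus M + t) mod modulus M"
    by (simp add: mod_simps algebra_simps)
  then show ?thesis
    by (simp add: Pair sw_step_def relabel_vert_def cyclic_group_mult map_from_tl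
        flip: map_from_snoc)
qed

lemma relabel_vert_closed:
  assumes "\<And>q x. x < k \<Longrightarrow> \<sigma> q x < k" and "v \<in> sw_verts k N M"
  shows "relabel_vert M \<sigma> t i v \<in> sw_verts k N M"
proof (cases v)
  case (Pair xs c)
  then have "set (map_from \<sigma> i xs) \<subseteq> {..<k}"
    using assms by (intro set_map_from_subset[where A = "{..<k}"]) (auto simp: sw_verts_def)
  then show ?thesis
    using assms(2) by (simp add: Pair relabel_vert_def sw_verts_def carrier_cyclic_group_iff)
qed

text \<open>The relabellings that occur are built from transpositions, so the same \<sigma> undoes
  itself and only the rotation changes sign. The level \<open>i\<close> remains that of the source,
  since positions are counted before the rotation.\<close>

lemma relabel_vert_inverse:
  assumes "\<And>q x. \<sigma> q (\<sigma> q x) = x" and "v \<in> sw_verts k N M"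
  shows "relabel_vert M \<sigma> (- t) i (relabel_vert M \<sigma> t i v) = v"
  using assms by (auto simp: relabel_vert_def sw_verts_def carrier_cyclic_group_iff
      map_from_inverse mod_simps)

lemma relabel_arc_inverse:
  assumes "\<And>q x. \<sigma> q (\<sigma> q x) = x" and "fst e \<in> sw_verts k N M"
  shows "relabel_arc M \<sigma> (- t) i (relabel_arc M \<sigma> t i e) = e"
  using assms relabel_vert_inverse[of \<sigma> "fst e" k N M t i]
  by (auto simp: relabel_arc_def relabel_vert_def split: prod.splits)

section \<open>Transitivity for large \<open>M\<close>\<close>

text \<open>\<open>app_iso h G = G\<close> is an equality of records, so the incidence maps stored
  in \<open>h\<close> have to agree with those of \<open>G\<close> even outside the arcs.\<close>

lemma digraph_automorphismI:
  assumes "wf_digraph G" and "bij_betw f (verts G) (verts G)" and "bij_betw g (arcs G) (arcs G)"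
    and "\<And>a. a \<in> arcs G \<Longrightarrow> tail G (g a) = f (tail G a)"
    and "\<And>a. a \<in> arcs G \<Longrightarrow> head G (g a) = f (head G a)"
  shows "\<lparr>iso_verts = f, iso_arcs = g, iso_head = head G, iso_tail = tail G\<rparr>
           \<in> digraph_automorphisms G"
proof -
  let ?h = "\<lparr>iso_verts = f, iso_arcs = g, iso_head = head G, iso_tail = tail G\<rparr>"
  have "pre_digraph.digraph_isomorphism G ?h"
    unfolding pre_digraph.digraph_isomorphism_def
    using assms by (simp add: bij_betw_imp_inj_on)
  moreover have "app_iso ?h G = G"
    using assms(2,3) by (simp add: app_iso_def bij_betw_imp_surj_on)
  ultimately show ?thesis
    by (simp add: digraph_automorphisms_def)
qed

text \<open>Periodicity lets the residue stored in a vertex serve as its level, although it is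
  reduced after each arc and after the rotation by \<open>t\<close>.\<close>

lemma relabel_automorphism:
  fixes t :: int
  assumes "M \<ge> 1"
    and closed: "\<And>q x. x < k \<Longrightarrow> \<sigma> q x < k"
    and invol: "\<And>q x. \<sigma> q (\<sigma> q x) = x"
    and periodic: "\<And>q. \<sigma> (q mod modulus M) = \<sigma> q"
  shows "\<exists>h \<in> digraph_automorphisms (oriented_spider_web k N M).
           iso_verts h = (\<lambda>v. relabel_vert M \<sigma> t (snd v) v)"
proof -
  let ?G = "oriented_spider_web k N M"
  let ?f = "\<lambda>v. relabel_vert M \<sigma> t (snd v) v"
  \<comment> \<open>Subtracting \<open>t\<close> recovers the source level only up to the modulus;
    \<open>cong\<close> absorbs the difference.\<close>
  let ?f' = "\<lambda>v. relabel_vert M \<sigma> (- t) (snd v - t) v"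
  let ?g = "\<lambda>e. relabel_arc M \<sigma> t (snd (fst e)) e"
  let ?g' = "\<lambda>e. relabel_arc M \<sigma> (- t) (snd (fst e) - t) e"
  have cong: "relabel_vert M \<sigma> s i = relabel_vert M \<sigma> s j"
    if "i mod modulus M = j mod modulus M" for s i j
    using map_from_mod[of \<sigma> "modulus M", OF periodic] that
    by (auto simp: relabel_vert_def fun_eq_iff) metis
  have cong_arc: "relabel_arc M \<sigma> s i = relabel_arc M \<sigma> s j"
    if "i mod modulus M = j mod modulus M" for s i j
  proof -
    have "\<sigma> (i + n) = \<sigma> (j + n)" for n
      using periodic[of "i + n"] periodic[of "j + n"] mod_add_cong[OF that refl, of n] by simp
    then show ?thesis
      using cong[OF that] by (auto simp: relabel_arc_def fun_eq_iff)
  qed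
  have snd_relabel: "snd (relabel_vert M \<sigma> s i v) = (snd v + s) mod modulus M" for s i v
    by (simp add: relabel_vert_def split: prod.splits)
  have fst_relabel: "fst (relabel_arc M \<sigma> s i e) = relabel_vert M \<sigma> s i (fst e)" for s i e
    by (simp add: relabel_arc_def split: prod.splits)
  have f'f: "?f' (?f v) = v" if "v \<in> sw_verts k N M" for v
    using relabel_vert_inverse[of \<sigma> v, OF invol that]
      cong[of "snd (?f v) - t" "snd v" "- t"] by (simp add: snd_relabel mod_simps)
  have ff': "?f (?f' v) = v" if "v \<in> sw_verts k N M" for v
    using relabel_vert_inverse[of \<sigma> v k N M "- t" "snd v - t", OF invol that]
      cong[of "snd (?f' v)" "snd v - t" t] by (simp add: snd_relabel mod_simps)
  have g'g: "?g' (?g e) = e" if "fst e \<in> sw_verts k N M" for e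
    using relabel_arc_inverse[of \<sigma> e, OF invol that]
      cong_arc[of "snd (fst (?g e)) - t" "snd (fst e)" "- t"]
    by (simp add: snd_relabel fst_relabel mod_simps)
  have gg': "?g (?g' e) = e" if "fst e \<in> sw_verts k N M" for e
    using relabel_arc_inverse[of \<sigma> e k N M "- t" "snd (fst e) - t", OF invol that]
      cong_arc[of "snd (fst (?g' e))" "snd (fst e) - t" t]
    by (simp add: snd_relabel fst_relabel mod_simps)
  have arc_closed: "relabel_arc M \<sigma> s i e \<in> arcs ?G" if "e \<in> arcs ?G" for s i e
    using that closed relabel_vert_closed[of k \<sigma> "fst e" N M s i, OF closed]
    by (auto simp: oriented_spider_web_def relabel_arc_def split: prod.splits)
  have "bij_betw ?f (verts ?G) (verts ?G)"
    by (rule bij_betw_byWitness[where f' = ?f'])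
      (auto simp: oriented_spider_web_def f'f ff' intro: relabel_vert_closed[OF closed])
  moreover have "bij_betw ?g (arcs ?G) (arcs ?G)"
  proof (rule bij_betw_byWitness[where f' = ?g'])
    show "\<forall>e\<in>arcs ?G. ?g' (?g e) = e" "\<forall>e\<in>arcs ?G. ?g (?g' e) = e"
      using g'g gg' by (auto simp: oriented_spider_web_def)
  qed (use arc_closed in auto)
  moreover have "tail ?G (?g e) = ?f (tail ?G e)" for e
    by (simp add: oriented_spider_web_def fst_relabel)
  moreover have "head ?G (?g e) = ?f (head ?G e)" for e
  proof (cases e)
    case (Pair v y)
    have "(snd v + 1) mod modulus M = snd (sw_step M v y) mod modulus M"
      by (simp add: sw_step_def cyclic_group_mult split: prod.splits)
    from cong[OF this] show ?thesis
      by (simp add: Pair oriented_spider_web_def relabel_arc_def sw_step_relabel)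
  qed
  ultimately show ?thesis
    using digraph_automorphismI[OF wf_oriented_spider_web[OF assms(1)], of ?f k N ?g] by force
qed

lemma transitive_oriented_spider_web:
  assumes "M \<ge> 1" and "M \<ge> enat N"
  shows "weakly_vertex_transitive_digraph (oriented_spider_web k N M)"
  unfolding weakly_vertex_transitive_digraph_def transitive_on_verts_def
proof (intro ballI)
  fix u v
  assume "u \<in> verts (oriented_spider_web k N M)" "v \<in> verts (oriented_spider_web k N M)"
  then obtain xs i ys j where u: "u = (xs, i)" and v: "v = (ys, j)"
    and len: "length xs = N" "length ys = N"
    and letters: "set xs \<subseteq> {..<k}" "set ys \<subseteq> {..<k}"
    and j: "j mod modulus M = j"
    by (auto simp: oriented_spider_web_def sw_verts_def carrier_cyclic_group_iff)
  \<comment> \<open>At every position congruent to \<open>i + n\<close> with \<open>n < N\<close>,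
    the letters \<open>xs ! n\<close> and \<open>ys ! n\<close> are exchanged. The range test also
    discards the negative offsets possible for \<open>M = \<infinity>\<close>, where
    \<open>nat\<close> would give 0.\<close>
  define \<sigma> where "\<sigma> p = (let n = (p - i) mod modulus M in
    if n \<in> {0..<int N} then Transposition.transpose (xs ! nat n) (ys ! nat n) else id)" for p
  have "xs ! n < k" "ys ! n < k" if "n < N" for n
    using that len letters nth_mem by (metis lessThan_iff subsetD)+
  then have "\<sigma> q x < k" if "x < k" for q x
    using that by (auto simp: \<sigma>_def Let_def Transposition.transpose_def)
  moreover have "\<sigma> q (\<sigma> q x) = x" for q x
    by (simp add: \<sigma>_def Let_def)
  moreover have "\<sigma> (q mod modulus M) = \<sigma> q" for q
    by (simp add: \<sigma>_def mod_simps)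
  ultimately obtain h where h: "h \<in> digraph_automorphisms (oriented_spider_web k N M)"
    and verts_h: "iso_verts h = (\<lambda>v. relabel_vert M \<sigma> (j - i) (snd v) v)"
    using relabel_automorphism[of M k \<sigma> N "j - i", OF assms(1)] by blast
  \<comment> \<open>Here \<open>M \<ge> N\<close> enters: the places of one word have distinct
    residues, so their prescribed exchanges cannot conflict.\<close>
  have "int n mod modulus M = int n" if "n < N" for n
    using that assms(2) by (cases M) (auto simp: modulus_def)
  then have "\<sigma> (i + int n) (xs ! n) = ys ! n" if "n < N" for n
    using that by (simp add: \<sigma>_def)
  then have "map_from \<sigma> i xs = ys"
    using len by (intro nth_equalityI) (auto simp: nth_map_from)
  then have "iso_verts h u = v"
    by (simp add: verts_h u v relabel_vert_def j)
  then show "\<exists>h\<in>digraph_automorphisms (oriented_spider_web k N M). iso_verts h u = v"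
    using h by blast
qed

text \<open>An automorphism extends to both directions of each arc; keeping the direction bit makes
  it commute with formal inversion.\<close>

lemma transitive_underlying_graph:
  assumes "weakly_vertex_transitive_digraph G"
  shows "weakly_vertex_transitive_graph (underlying_graph G) (underlying_rev G)"
  unfolding weakly_vertex_transitive_graph_def transitive_on_verts_def
proof (intro ballI)
  fix u v
  assume "u \<in> verts (underlying_graph G)" "v \<in> verts (underlying_graph G)"
  then obtain h where iso: "pre_digraph.digraph_isomorphism G h" and app: "app_iso h G = G"
    and uv: "iso_verts h u = v"
    using assms by (auto simp: weakly_vertex_transitive_digraph_def transitive_on_verts_def
        digraph_automorphisms_def underlying_graph_def)
  have wf: "wf_digraph G" and inj: "inj_on (iso_verts h) (verts G)" "inj_on (iso_arcs h) (arcs G)"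
    using iso by (auto simp: pre_digraph.digraph_isomorphism_def)
  have surj: "iso_verts h ` verts G = verts G" "iso_arcs h ` arcs G = arcs G"
    and ends: "iso_tail h = tail G" "iso_head h = head G"
    by (metis app app_iso_simps)+
  let ?g = "map_prod (iso_arcs h) id :: _ \<times> bool \<Rightarrow> _"
  let ?h = "\<lparr>iso_verts = iso_verts h, iso_arcs = ?g,
    iso_head = head (underlying_graph G), iso_tail = tail (underlying_graph G)\<rparr>"
  interpret U: bidirected_digraph "underlying_graph G" "underlying_rev G"
    using wf by (rule bidirected_underlying_graph)
  have "?h \<in> digraph_automorphisms (underlying_graph G)"
  proof (rule digraph_automorphismI[OF U.wf_digraph_axioms])
    show "bij_betw (iso_verts h) (verts (underlying_graph G)) (verts (underlying_graph G))"
      using inj surj by (simp add: underlying_graph_def bij_betw_def)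
    show "bij_betw ?g (arcs (underlying_graph G)) (arcs (underlying_graph G))"
      using inj surj by (auto simp: underlying_graph_def bij_betw_def map_prod_surj_on
          intro!: map_prod_inj_on)
  qed (use pre_digraph.iso_verts_tail[OF iso] pre_digraph.iso_verts_head[OF iso] in
      \<open>auto simp: underlying_graph_def ends\<close>)
  moreover have "?g (underlying_rev G a) = underlying_rev G (?g a)"
    if "a \<in> arcs (underlying_graph G)" for a
    using that surj by (auto simp: underlying_graph_def underlying_rev_def)
  ultimately have "?h \<in> graph_automorphisms (underlying_graph G) (underlying_rev G)"
    by (simp add: graph_automorphisms_def)
  then show "\<exists>h\<in>graph_automorphisms (underlying_graph G) (underlying_rev G). iso_verts h u = v"
    using uv by (intro bexI[of _ ?h]) auto
qed

section \<open>Closed walks of length \<open>M\<close>\<close>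

definition closed_walks :: "('a, 'b) pre_digraph \<Rightarrow> nat \<Rightarrow> 'a \<Rightarrow> 'b list set" where
  "closed_walks G n v = {p. length p = n \<and> pre_digraph.awalk G v p v}"

lemma finite_closed_walks:
  assumes "finite (arcs G)"
  shows "finite (closed_walks G n v)"
  by (rule finite_subset[OF _ finite_lists_length_eq[OF assms, of n]])
    (auto simp: closed_walks_def pre_digraph.awalk_def)

text \<open>Walks are mapped arc by arc, injectively. Finiteness guards against \<open>card\<close>
  being 0 on infinite sets. Nothing is asked of original arcs in the spider-web, so automorphisms
  reversing some of them are covered.\<close>

lemma card_closed_walks_automorphism:
  assumes "h \<in> digraph_automorphisms G" and "finite (arcs G)"
  shows "card (closed_walks G n v) \<le> card (closed_walks G n (iso_verts h v))"
proof (rule card_inj_on_le[of "map (iso_arcs h)"])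
  have iso: "pre_digraph.digraph_isomorphism G h" and app: "app_iso h G = G"
    using assms(1) by (auto simp: digraph_automorphisms_def)
  then interpret wf_digraph G
    by (simp add: pre_digraph.digraph_isomorphism_def)
  have "inj_on (iso_arcs h) (arcs G)"
    using iso by (simp add: digraph_isomorphism_def)
  then show "inj_on (map (iso_arcs h)) (closed_walks G n v)"
    by (rule inj_on_mapI[OF inj_on_subset]) (auto simp: closed_walks_def awalk_def)
  show "map (iso_arcs h) ` closed_walks G n v \<subseteq> closed_walks G n (iso_verts h v)"
    using awalk_app_isoI[OF _ iso] app by (auto simp: closed_walks_def)
qed (rule finite_closed_walks[OF assms(2)])

section \<open>Net displacement and relabelling of lifted walks\<close>

definition displacement :: "('e \<times> bool) list \<Rightarrow> int" where
  "displacement p = (\<Sum>a\<leftarrow>p. if snd a then 1 else - 1)"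

lemma displacement_simps [simp]:
  "displacement [] = 0"
  "displacement ((e, b) # p) = (if b then 1 else - 1) + displacement p"
  by (simp_all add: displacement_def)

lemma abs_displacement_le: "\<bar>displacement p\<bar> \<le> int (length p)"
proof (induction p)
  case (Cons a p)
  then show ?case
    by (cases a; cases "snd a") simp_all
qed simp

lemma displacement_eq_length_iff: "displacement p = int (length p) \<longleftrightarrow> snd ` set p \<subseteq> {True}"
proof (induction p)
  case (Cons a p)
  then show ?case
    using abs_displacement_le[of p] by (cases a; cases "snd a") simp_all
qed simp

lemma displacement_eq_minus_length_iff:
  "displacement p = - int (length p) \<longleftrightarrow> snd ` set p \<subseteq> {False}"
proof (induction p)
  case (Cons a p)
  then show ?case
    using abs_displacement_le[of p] by (cases a; cases "snd a") simp_all
qed simp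

text \<open>The walk is lifted to the cover with levels in \<open>\<int>\<close>, starting at level \<open>i\<close>, and relabelled there.\<close>

fun relabel_walk :: "enat \<Rightarrow> (int \<Rightarrow> nat \<Rightarrow> nat) \<Rightarrow> int \<Rightarrow>
    ((sw_vertex \<times> nat) \<times> bool) list \<Rightarrow> ((sw_vertex \<times> nat) \<times> bool) list" where
  "relabel_walk M \<sigma> i [] = []"
| "relabel_walk M \<sigma> i ((e, True) # p) =
     (relabel_arc M \<sigma> 0 i e, True) # relabel_walk M \<sigma> (i + 1) p"
| "relabel_walk M \<sigma> i ((e, False) # p) =
     (relabel_arc M \<sigma> 0 (i - 1) e, False) # relabel_walk M \<sigma> (i - 1) p"

lemma length_relabel_walk [simp]: "length (relabel_walk M \<sigma> i p) = length p"
  by (induction M \<sigma> i p rule: relabel_walk.induct) auto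

lemma displacement_relabel_walk [simp]: "displacement (relabel_walk M \<sigma> i p) = displacement p"
  by (induction M \<sigma> i p rule: relabel_walk.induct) auto

lemma relabel_walk_inverse:
  assumes "\<And>q x. \<sigma> q (\<sigma> q x) = x" and "set p \<subseteq> arcs (spider_web k N M)"
  shows "relabel_walk M \<sigma> i (relabel_walk M \<sigma> i p) = p"
  using assms(2)
proof (induction p arbitrary: i)
  case (Cons a p)
  then have "fst (fst a) \<in> sw_verts k N M"
    by (auto simp: spider_web_def underlying_graph_def oriented_spider_web_def)
  then have "relabel_arc M \<sigma> 0 j (relabel_arc M \<sigma> 0 j (fst a)) = fst a" for j
    using relabel_arc_inverse[of \<sigma> "fst a" k N M 0 j] assms(1) by simp
  then show ?case
    using Cons by (cases a; cases "snd a") auto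
qed simp

lemma spider_web_sel:
  "verts (spider_web k N M) = sw_verts k N M"
  "arcs (spider_web k N M) = (sw_verts k N M \<times> {..<k}) \<times> UNIV"
  "tail (spider_web k N M) ((v, y), b) = (if b then v else sw_step M v y)"
  "head (spider_web k N M) ((v, y), b) = (if b then sw_step M v y else v)"
  by (simp_all add: spider_web_def underlying_graph_def oriented_spider_web_def)

lemma finite_arcs_spider_web:
  assumes "m \<ge> 1"
  shows "finite (arcs (spider_web k N (enat m)))"
proof -
  have "carrier (cyclic_group (enat m)) = {0..<int m}"
    using assms by (simp add: cyclic_group_def integer_mod_group_def)
  moreover have "finite {xs. length xs = N \<and> set xs \<subseteq> {..<k}}"
    using finite_lists_length_eq[of "{..<k}" N] by (simp add: conj_commute)
  ultimately show ?thesis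
    by (simp add: spider_web_sel sw_verts_def)
qed

section \<open>Walks in the non-oriented spider-web graph\<close>

context
  fixes k N :: nat and M :: enat
  assumes M: "M \<ge> 1"
begin

interpretation SW: wf_digraph "spider_web k N M"
  using bidirected_spider_web[OF M] by (simp add: bidirected_digraph_def)

text \<open>The level is tracked in the integers, so \<sigma> need not be periodic. With
  displacement 0 both ends of a closed walk are relabelled at the same level, and the image is
  closed again.\<close>

lemma awalk_relabel_walk:
  assumes "\<And>q x. x < k \<Longrightarrow> \<sigma> q x < k"
    and "SW.awalk u p v"
  shows "SW.awalk (relabel_vert M \<sigma> 0 i u) (relabel_walk M \<sigma> i p)
           (relabel_vert M \<sigma> 0 (i + displacement p) v)"
  using assms(2)
proof (induction p arbitrary: u i)
  case Nil
  then show ?case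
    by (auto simp: SW.awalk_Nil_iff spider_web_sel intro: relabel_vert_closed[OF assms(1)])
next
  case (Cons a p)
  obtain w y b where a: "a = ((w, y), b)"
    by (metis surj_pair)
  have w: "w \<in> sw_verts k N M" "y < k"
    using Cons.prems by (auto simp: a SW.awalk_Cons_iff spider_web_sel)
  have closed: "relabel_vert M \<sigma> 0 j w \<in> sw_verts k N M" "\<sigma> j y < k" for j
    using relabel_vert_closed[of k \<sigma>, OF assms(1) w(1)] assms(1) w(2) by auto
  show ?case
  proof (cases b)
    case True
    then show ?thesis
      using Cons.prems Cons.IH[of "sw_step M w y" "i + 1"] closed
      by (auto simp: a SW.awalk_Cons_iff spider_web_sel relabel_arc_def sw_step_relabel add.assoc)
  next
    \<comment> \<open>A reversed arc starts at level \<open>i - 1\<close> and has the current vertex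
      as its head, so the commutation is applied at \<open>i - 1\<close>.\<close>
    case False
    then show ?thesis
      using Cons.prems Cons.IH[of w "i - 1"] closed sw_step_relabel[of M \<sigma> 0 "i - 1" w y]
      by (auto simp: a SW.awalk_Cons_iff spider_web_sel relabel_arc_def algebra_simps)
  qed
qed

lemma awalk_level:
  assumes "SW.awalk u p v"
  shows "snd v = (snd u + displacement p) mod modulus M"
  using assms
proof (induction p arbitrary: u)
  case Nil
  then show ?case
    by (auto simp: SW.awalk_Nil_iff spider_web_sel sw_verts_def carrier_cyclic_group_iff)
next
  case (Cons a p)
  obtain w y b where a: "a = ((w, y), b)"
    by (metis surj_pair)
  have step: "snd (sw_step M w y) = (snd w + 1) mod modulus M"
    by (simp add: sw_step_def cyclic_group_mult split: prod.splits)
  \<comment> \<open>This serves a backward first step, which starts one level above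
    \<open>w\<close>.\<close>
  have "((snd w + 1) mod modulus M + (displacement p - 1)) mod modulus M =
      (snd w + displacement p) mod modulus M"
    by (simp add: mod_simps)
  then show ?case
    using Cons.prems Cons.IH[of "head (spider_web k N M) a"]
    by (cases b) (auto simp: a SW.awalk_Cons_iff spider_web_sel step mod_simps algebra_simps)
qed

lemma nth_sw_step: "Suc n < length (fst v) \<Longrightarrow> fst (sw_step M v y) ! n = fst v ! Suc n"
  by (cases v) (auto simp: sw_step_def nth_tl nth_append)

text \<open>Each forward step shifts the surviving letters one place to the left. A closed forward
  walk thus forces its word to have period \<open>length p\<close>.\<close>

lemma forward_walk_letters:
  assumes "SW.awalk u p v" and "snd ` set p \<subseteq> {True}" and "n + length p < N"
  shows "fst v ! n = fst u ! (n + length p)"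
  using assms
proof (induction p arbitrary: u)
  case (Cons a p)
  obtain w y where a: "a = ((w, y), True)"
    using Cons.prems(2) by (cases a) auto
  then show ?case
    using Cons.prems Cons.IH[of "sw_step M w y"] nth_sw_step[of "n + length p" w y]
    by (auto simp: SW.awalk_Cons_iff spider_web_sel sw_verts_def)
qed (auto simp: SW.awalk_Nil_iff)

lemma backward_walk_letters:
  assumes "SW.awalk u p v" and "snd ` set p \<subseteq> {False}" and "n + length p < N"
  shows "fst u ! n = fst v ! (n + length p)"
  using assms
proof (induction p arbitrary: u n)
  case (Cons a p)
  obtain w y where a: "a = ((w, y), False)"
    using Cons.prems(2) by (cases a) auto
  then show ?case
    using Cons.prems Cons.IH[of w "Suc n"] nth_sw_step[of n w y]
    by (auto simp: SW.awalk_Cons_iff spider_web_sel sw_verts_def)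
qed (auto simp: SW.awalk_Nil_iff)

text \<open>Appending \<open>x\<close> fixes the constant word, so only the level moves; the walk
  closes once \<open>n\<close> is a multiple of the modulus.\<close>

lemma constant_forward_walk:
  assumes "x < k"
  shows "\<exists>p. length p = n \<and> snd ` set p \<subseteq> {True} \<and>
    SW.awalk (replicate N x, i mod modulus M) p (replicate N x, (i + int n) mod modulus M)"
proof (induction n arbitrary: i)
  case 0
  then show ?case
    using assms by (auto simp: SW.awalk_Nil_iff spider_web_sel sw_verts_def carrier_cyclic_group_iff)
next
  case (Suc n)
  obtain p where p: "length p = n" "snd ` set p \<subseteq> {True}"
    "SW.awalk (replicate N x, (i + 1) mod modulus M) p
       (replicate N x, (i + 1 + int n) mod modulus M)"
    using Suc.IH by metis
  let ?v = "(replicate N x, i mod modulus M)"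
  have "tl (replicate N x @ [x]) = replicate N x"
    by (cases N) (auto simp: replicate_append_same)
  then have "sw_step M ?v x = (replicate N x, (i + 1) mod modulus M)"
    by (simp add: sw_step_def cyclic_group_mult mod_simps)
  moreover have "?v \<in> sw_verts k N M"
    using assms by (auto simp: sw_verts_def carrier_cyclic_group_iff)
  ultimately show ?case
    using p assms
    by (intro exI[of _ "((?v, x), True) # p"])
      (auto simp: SW.awalk_Cons_iff spider_web_sel algebra_simps)
qed

end

lemma not_transitive_spider_web:
  assumes "k \<ge> 2" and "m \<ge> 1" and "m < N"
  shows "\<not> weakly_vertex_transitive_graph (spider_web k N (enat m)) (spider_web_rev k N (enat m))"
proof
  let ?G = "spider_web k N (enat m)"
  \<comment> \<open>The word of \<open>?d\<close> is not \<open>m\<close>-periodic: its last letter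
    differs from the one \<open>m\<close> places earlier, which exists because
    \<open>m < N\<close>.\<close>
  let ?c = "(replicate N 0, 0) :: sw_vertex" and ?d = "(replicate (N - 1) 0 @ [1], 0) :: sw_vertex"
  have M: "enat m \<ge> 1"
    using assms by (simp add: one_enat_def)
  interpret wf_digraph ?G
    using bidirected_spider_web[OF M] by (simp add: bidirected_digraph_def)
  have c: "?c \<in> verts ?G" and d: "?d \<in> verts ?G"
    using assms by (auto simp: spider_web_sel sw_verts_def carrier_cyclic_group_iff)
  have fin: "finite (arcs ?G)"
    using assms finite_arcs_spider_web by simp
  \<comment> \<open>The exchange happens only at the absolute position of the last letter of
    \<open>?d\<close> at level 0. It is not \<open>m\<close>-periodic, hence usable only on lifted
    walks.\<close>
  define \<sigma> :: "int \<Rightarrow> nat \<Rightarrow> nat"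
    where "\<sigma> q = (if q = int N - 1 then Transposition.transpose 0 1 else id)" for q
  have closed: "\<sigma> q x < k" if "x < k" for q x
    using that assms by (auto simp: \<sigma>_def Transposition.transpose_def)
  have invol: "\<sigma> q (\<sigma> q x) = x" for q x
    by (simp add: \<sigma>_def)
  have "map_from \<sigma> 0 (replicate (N - 1) 0 @ [1]) = replicate N 0"
    using assms by (intro nth_equalityI) (auto simp: nth_map_from \<sigma>_def nth_append)
  then have relabel_d: "relabel_vert (enat m) \<sigma> 0 0 ?d = ?c"
    by (simp add: relabel_vert_def)
  have disp_d: "displacement p = 0" if p: "p \<in> closed_walks ?G m ?d" for p
  proof -
    have len: "length p = m" and walk: "awalk ?d p ?d"
      using p by (auto simp: closed_walks_def)
    have last: "fst ?d ! (N - 1 - m) \<noteq> fst ?d ! (N - 1 - m + length p)"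
      using assms len by (auto simp: nth_append)
    have "displacement p \<noteq> int m"
      using forward_walk_letters[OF M walk, of "N - 1 - m"] last displacement_eq_length_iff[of p] len assms
      by auto
    moreover have "displacement p \<noteq> - int m"
      using backward_walk_letters[OF M walk, of "N - 1 - m"] last displacement_eq_minus_length_iff[of p] len assms
      by auto
    \<comment> \<open>A multiple of \<open>m\<close> of absolute value at most \<open>m\<close>, but
      neither \<open>m\<close> nor \<open>- m\<close>, is 0.\<close>
    moreover have "int m dvd displacement p"
      using awalk_level[OF M walk] by (simp add: dvd_eq_mod_eq_0)
    ultimately show ?thesis
      using abs_displacement_le[of p] len dvd_imp_le_int[of "displacement p" "int m"] by fastforce
  qed
  \<comment> \<open>One forward turn around the levels gives \<open>?c\<close> a closed walk of
    displacement \<open>m\<close>, missed by the relabelling because that preserves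
    displacement.\<close>
  obtain p\<^sub>0 where p\<^sub>0: "length p\<^sub>0 = m" "snd ` set p\<^sub>0 \<subseteq> {True}" "awalk ?c p\<^sub>0 ?c"
    using constant_forward_walk[OF M, of 0 k m N 0] assms by auto
  then have "displacement p\<^sub>0 \<noteq> 0"
    using displacement_eq_length_iff[of p\<^sub>0] assms by auto
  then have "p\<^sub>0 \<notin> relabel_walk (enat m) \<sigma> 0 ` closed_walks ?G m ?d"
    using disp_d by auto
  moreover have "relabel_walk (enat m) \<sigma> 0 p \<in> closed_walks ?G m ?c"
    if p: "p \<in> closed_walks ?G m ?d" for p
    using awalk_relabel_walk[OF M, of k \<sigma> N ?d p ?d 0] p disp_d[OF p] relabel_d closed
    by (simp add: closed_walks_def)
  moreover have "p\<^sub>0 \<in> closed_walks ?G m ?c"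
    using p\<^sub>0 by (simp add: closed_walks_def)
  ultimately have sub:
    "relabel_walk (enat m) \<sigma> 0 ` closed_walks ?G m ?d \<subset> closed_walks ?G m ?c"
    by blast
  have "inj_on (relabel_walk (enat m) \<sigma> 0) (closed_walks ?G m ?d)"
    by (rule inj_on_inverseI[where g = "relabel_walk (enat m) \<sigma> 0"])
      (auto simp: closed_walks_def awalk_def intro: relabel_walk_inverse[OF invol])
  then have less: "card (closed_walks ?G m ?d) < card (closed_walks ?G m ?c)"
    using psubset_card_mono[OF finite_closed_walks[OF fin] sub] by (simp add: card_image)
  assume "weakly_vertex_transitive_graph ?G (spider_web_rev k N (enat m))"
  \<comment> \<open>The direction matters: \<open>h\<close> leads from the vertex with more closed
    walks to the one with fewer, against the inequality for automorphisms.\<close>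
  then obtain h where "h \<in> digraph_automorphisms ?G" "iso_verts h ?c = ?d"
    using c d unfolding weakly_vertex_transitive_graph_def transitive_on_verts_def
      graph_automorphisms_def by blast
  with card_closed_walks_automorphism[of h ?G m ?c, OF _ fin] less show False
    by simp
qed

theorem theorem6p11:
  fixes k N :: nat and M :: enat
  assumes "k \<ge> 2" and "M \<ge> 1"
  shows "(weakly_vertex_transitive_digraph (oriented_spider_web k N M) \<longleftrightarrow> M \<ge> enat N) \<and>
         (weakly_vertex_transitive_graph (spider_web k N M) (spider_web_rev k N M) \<longleftrightarrow> M \<ge> enat N)"
proof -
  \<comment> \<open>Three implications in a cycle give both equivalences: \<open>M \<ge> N\<close>,
    oriented transitivity, non-oriented transitivity, and back.\<close>
  have "M \<ge> enat N" if "weakly_vertex_transitive_graph (spider_web k N M) (spider_web_rev k N M)"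
    using that not_transitive_spider_web[OF assms(1)] assms(2)
    by (cases M) (auto simp: one_enat_def not_le[symmetric])
  moreover have "weakly_vertex_transitive_graph (spider_web k N M) (spider_web_rev k N M)"
    if "weakly_vertex_transitive_digraph (oriented_spider_web k N M)"
    using transitive_underlying_graph[OF that] by (simp add: spider_web_def spider_web_rev_def)
  ultimately show ?thesis
    using transitive_oriented_spider_web[OF assms(2)] by blast
qed

end
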